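(* From the axioms of Extensionality, Pairing, Bounded Separation and Bounded Replacement one can prove $AC \rightarrow AC^*$, where $$AC \equiv \forall x [AC_{h,1}(x) \wedge AC_{h,2}(x) \rightarrow \exists y\, C(y,x)]$$ and $$AC^* \equiv \forall x (AC_h^*(x) \rightarrow \exists y (y \notin x \wedge C(y,x))).$$
   Context: The language is first-order predicate calculus with equality and one binary relation symbol $\in$ (models have non-empty domain). $z \neq \emptyset$ abbreviates $\exists b\, b \in z$, and $z \cap z' = \emptyset$ abbreviates $\neg\exists a (a \in z \wedge a \in z')$. $C(y,x)$ ("$y$ is a choice-set for $x$") is $$\forall z \in x\, (\exists b\, b \in z \rightarrow \exists a (a \in z \wedge a \in y \wedge \forall b (b \in z \wedge b \in y \rightarrow b = a))).$$ $AC_{h,1}(x) \equiv \forall z \in x\; z \neq \emptyset$. $AC_{h,2}(x) \equiv \forall z, z' \in x\, (z \neq z' \rightarrow z \cap z' = \emptyset)$. $AC_h^*(x) \equiv \forall z \in x\, \exists a \in z\, \forall z' \in x\, (z \neq z' \rightarrow a \notin z')$. Axioms (the schemes are closed universally over any other parameters; a bounded quantifier is one of the form $\forall u \in v$ or $\exists u \in v$): - Extensionality: $\forall x, y (\forall z (z \in x \leftrightarrow z \in y) \rightarrow x = y)$. - Pairing: $\forall x, y \exists z \forall a (a \in z \leftrightarrow a = x \vee a = y)$. - Bounded Separation: for each formula $\varphi$ in which all quantifiers are bounded and $y$ is not free, $\forall x \exists y \forall z (z \in y \leftrightarrow z \in x \wedge \varphi)$. - Bounded Replacement: for each formula $\phi$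 in which all quantifiers are bounded and $y$ is not free, $\forall x (\forall z \exists! z' \phi \rightarrow \exists y \forall z \in x\, \exists z' \in y\; \phi)$. *)

theory Defs
  imports Main
begin

section \<open>First-order formulas over equality and one binary relation symbol\<close>

text \<open>
  Variables are de Bruijn indices: inside a quantifier, index \<open>0\<close> is the variable bound by the
  innermost quantifier, and an outer variable \<open>i\<close> appears as \<open>i + 1\<close>. There are no function
  symbols or constants, so the terms are exactly the variables. Each definition of a concrete
  formula is followed by a \<open>sat\<close> lemma that spells out its meaning with named variables.
\<close>

datatype form =
    Bot
  | Eq nat nat
  | Mem nat nat
  | Imp form form
  | Con form form
  | Dis form form
  | Forall form
  | Exists form

definition Neg :: "form \<Rightarrow> form" where
  "Neg p = Imp p Bot"

definition Iff :: "form \<Rightarrow> form \<Rightarrow> form" where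
  "Iff p q = Con (Imp p q) (Imp q p)"

fun fv :: "form \<Rightarrow> nat set" where
  "fv Bot = {}"
| "fv (Eq x y) = {x, y}"
| "fv (Mem x y) = {x, y}"
| "fv (Imp p q) = fv p \<union> fv q"
| "fv (Con p q) = fv p \<union> fv q"
| "fv (Dis p q) = fv p \<union> fv q"
| "fv (Forall p) = {n. Suc n \<in> fv p}"
| "fv (Exists p) = {n. Suc n \<in> fv p}"

text \<open>
  \<open>ren r p\<close> replaces every free variable \<open>n\<close> of \<open>p\<close> by \<open>r n\<close>, without capture; \<open>up r\<close> is the
  action of \<open>r\<close> below one more quantifier. The instances used are:
  \<^item> \<open>lift p\<close>: \<open>p\<close> read below one more quantifier that does not bind any variable of \<open>p\<close>;
  \<^item> \<open>ren (up Suc) p\<close>: the same, except that the new variable is inserted at index \<open>1\<close>;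
  \<^item> \<open>ren (up (up Suc)) p\<close>: the same, with the new variable inserted at index \<open>2\<close>;
  \<^item> \<open>inst t p\<close>: the body \<open>p\<close> of a quantifier, with \<open>t\<close> substituted for the bound variable.
\<close>

fun up :: "(nat \<Rightarrow> nat) \<Rightarrow> nat \<Rightarrow> nat" where
  "up r 0 = 0"
| "up r (Suc n) = Suc (r n)"

fun ren :: "(nat \<Rightarrow> nat) \<Rightarrow> form \<Rightarrow> form" where
  "ren r Bot = Bot"
| "ren r (Eq x y) = Eq (r x) (r y)"
| "ren r (Mem x y) = Mem (r x) (r y)"
| "ren r (Imp p q) = Imp (ren r p) (ren r q)"
| "ren r (Con p q) = Con (ren r p) (ren r q)"
| "ren r (Dis p q) = Dis (ren r p) (ren r q)"
| "ren r (Forall p) = Forall (ren (up r) p)"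
| "ren r (Exists p) = Exists (ren (up r) p)"

definition lift :: "form \<Rightarrow> form" where
  "lift p = ren Suc p"

definition inst :: "nat \<Rightarrow> form \<Rightarrow> form" where
  "inst t p = ren (case_nat t (\<lambda>n. n)) p"


section \<open>Provability\<close>

text \<open>
  Classical natural deduction with equality. Lifting the hypotheses in \<open>AllI\<close> and \<open>ExE\<close> (and the
  conclusion in \<open>ExE\<close>) expresses the eigenvariable conditions. \<open>\<exists>x. x = x\<close> is derivable, in
  accordance with non-empty domains. The set of hypotheses may be infinite, but a derivation,
  being a finite tree, uses only finitely many of them.
\<close>

inductive provable :: "form set \<Rightarrow> form \<Rightarrow> bool"  (infix \<open>\<turnstile>\<close> 50) where
  Assm: "p \<in> H \<Longrightarrow> H \<turnstile> p"
| Contr: "insert (Neg p) H \<turnstile> Bot \<Longrightarrow> H \<turnstile> p"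
| ImpI: "insert p H \<turnstile> q \<Longrightarrow> H \<turnstile> Imp p q"
| ImpE: "H \<turnstile> Imp p q \<Longrightarrow> H \<turnstile> p \<Longrightarrow> H \<turnstile> q"
| ConI: "H \<turnstile> p \<Longrightarrow> H \<turnstile> q \<Longrightarrow> H \<turnstile> Con p q"
| ConE1: "H \<turnstile> Con p q \<Longrightarrow> H \<turnstile> p"
| ConE2: "H \<turnstile> Con p q \<Longrightarrow> H \<turnstile> q"
| DisI1: "H \<turnstile> p \<Longrightarrow> H \<turnstile> Dis p q"
| DisI2: "H \<turnstile> q \<Longrightarrow> H \<turnstile> Dis p q"
| DisE: "H \<turnstile> Dis p q \<Longrightarrow> insert p H \<turnstile> r \<Longrightarrow> insert q H \<turnstile> r \<Longrightarrow> H \<turnstile> r"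
| AllI: "lift ` H \<turnstile> p \<Longrightarrow> H \<turnstile> Forall p"
| AllE: "H \<turnstile> Forall p \<Longrightarrow> H \<turnstile> inst t p"
| ExI: "H \<turnstile> inst t p \<Longrightarrow> H \<turnstile> Exists p"
| ExE: "H \<turnstile> Exists p \<Longrightarrow> insert p (lift ` H) \<turnstile> lift q \<Longrightarrow> H \<turnstile> q"
| EqI: "H \<turnstile> Eq x x"
| EqE: "H \<turnstile> Eq x y \<Longrightarrow> H \<turnstile> inst x p \<Longrightarrow> H \<turnstile> inst y p"


section \<open>Satisfaction\<close>

text \<open>
  Satisfaction is not needed to define provability or the axioms. It serves to state the meaning
  of the concrete formulas below, and the soundness of the calculus.
\<close>

fun sat :: "('a \<Rightarrow> 'a \<Rightarrow> bool) \<Rightarrow> (nat \<Rightarrow> 'a) \<Rightarrow> form \<Rightarrow> bool" where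
  "sat E s Bot = False"
| "sat E s (Eq x y) = (s x = s y)"
| "sat E s (Mem x y) = E (s x) (s y)"
| "sat E s (Imp p q) = (sat E s p \<longrightarrow> sat E s q)"
| "sat E s (Con p q) = (sat E s p \<and> sat E s q)"
| "sat E s (Dis p q) = (sat E s p \<or> sat E s q)"
| "sat E s (Forall p) = (\<forall>a. sat E (case_nat a s) p)"
| "sat E s (Exists p) = (\<exists>a. sat E (case_nat a s) p)"

lemma sat_Neg [simp]: "sat E s (Neg p) = (\<not> sat E s p)"
  by (simp add: Neg_def)

lemma sat_Iff [simp]: "sat E s (Iff p q) = (sat E s p \<longleftrightarrow> sat E s q)"
  by (auto simp: Iff_def)

lemma case_nat_up: "(\<lambda>n. case_nat a s (up r n)) = case_nat a (\<lambda>n. s (r n))"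
  by (rule ext, case_tac n) auto

lemma sat_ren: "sat E s (ren r p) = sat E (\<lambda>n. s (r n)) p"
  by (induction p arbitrary: s r) (auto simp: case_nat_up)

lemma sat_lift [simp]: "sat E (case_nat a s) (lift p) = sat E s p"
  by (simp add: lift_def sat_ren)

lemma sat_inst: "sat E s (inst t p) = sat E (case_nat (s t) s) p"
proof -
  have "(\<lambda>n. s (case_nat t (\<lambda>n. n) n)) = case_nat (s t) s"
    by (rule ext, case_tac n) auto
  then show ?thesis
    by (simp add: inst_def sat_ren)
qed

lemma sat_ren_up [simp]:
  "sat E (case_nat a (case_nat b s)) (ren (up Suc) p) = sat E (case_nat a s) p"
  by (simp add: sat_ren case_nat_up)

lemma sat_ren_up_up [simp]:
  "sat E (case_nat a (case_nat b (case_nat c s))) (ren (up (up Suc)) p)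
   = sat E (case_nat a (case_nat b s)) p"
  by (simp add: sat_ren case_nat_up)

theorem soundness:
  assumes "H \<turnstile> p" and "\<forall>q\<in>H. sat E s q"
  shows "sat E s p"
  using assms
proof (induction arbitrary: s rule: provable.induct)
  case (AllI H p)
  then show ?case by simp
next
  case (AllE H p t)
  then show ?case by (simp add: sat_inst)
next
  case (ExI H t p)
  then show ?case by (auto simp: sat_inst)
next
  case (ExE H p q)
  from ExE.IH(1)[OF ExE.prems] obtain a where "sat E (case_nat a s) p"
    by auto
  moreover from ExE.prems have "\<forall>r\<in>lift ` H. sat E (case_nat a s) r"
    by simp
  ultimately have "sat E (case_nat a s) (lift q)"
    by (intro ExE.IH(2)) simp
  then show ?case by simp
next
  case (EqE H x y p)
  from EqE.IH(1)[OF EqE.prems] have "s x = s y"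
    by simp
  with EqE.IH(2)[OF EqE.prems] show ?case
    by (simp add: sat_inst)
next
  case (Contr p H)
  show ?case
  proof (rule ccontr)
    assume "\<not> sat E s p"
    with Contr.prems have "\<forall>q\<in>insert (Neg p) H. sat E s q"
      by simp
    from Contr.IH[OF this] show False
      by simp
  qed
next
  case (DisE H p q r)
  from DisE.IH(1)[OF DisE.prems] consider "sat E s p" | "sat E s q"
    by auto
  then show ?case
    using DisE.IH(2,3) DisE.prems by cases simp_all
qed simp_all


section \<open>Abbreviations\<close>

text \<open>
  \<open>BAll v p\<close> and \<open>BEx v p\<close> are \<open>\<forall>u \<in> v. p\<close> and \<open>\<exists>u \<in> v. p\<close>, where \<open>u\<close> is index \<open>0\<close> in \<open>p\<close>.
  The bounding variable \<open>v\<close> is taken outside the quantifier, so \<open>u\<close> and \<open>v\<close> are distinct.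
\<close>

definition BAll :: "nat \<Rightarrow> form \<Rightarrow> form" where
  "BAll v p = Forall (Imp (Mem 0 (Suc v)) p)"

definition BEx :: "nat \<Rightarrow> form \<Rightarrow> form" where
  "BEx v p = Exists (Con (Mem 0 (Suc v)) p)"

definition ExUnique :: "form \<Rightarrow> form" where
  "ExUnique p = Exists (Con p (Forall (Imp (ren (up Suc) p) (Eq 0 1))))"

lemma sat_BAll [simp]: "sat E s (BAll v p) = (\<forall>u. E u (s v) \<longrightarrow> sat E (case_nat u s) p)"
  by (simp add: BAll_def)

lemma sat_BEx [simp]: "sat E s (BEx v p) = (\<exists>u. E u (s v) \<and> sat E (case_nat u s) p)"
  by (simp add: BEx_def)

lemma sat_ExUnique [simp]: "sat E s (ExUnique p) = (\<exists>!a. sat E (case_nat a s) p)"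
  by (simp add: ExUnique_def Ex1_def)

inductive bounded :: "form \<Rightarrow> bool" where
  "bounded Bot"
| "bounded (Eq x y)"
| "bounded (Mem x y)"
| "bounded p \<Longrightarrow> bounded q \<Longrightarrow> bounded (Imp p q)"
| "bounded p \<Longrightarrow> bounded q \<Longrightarrow> bounded (Con p q)"
| "bounded p \<Longrightarrow> bounded q \<Longrightarrow> bounded (Dis p q)"
| "bounded p \<Longrightarrow> bounded (BAll v p)"
| "bounded p \<Longrightarrow> bounded (BEx v p)"


section \<open>The axioms\<close>

definition extensionality :: form where
  "extensionality = Forall (Forall (Imp (Forall (Iff (Mem 0 2) (Mem 0 1))) (Eq 1 0)))"

lemma sat_extensionality:
  "sat E s extensionality \<longleftrightarrow> (\<forall>x y. (\<forall>z. E z x \<longleftrightarrow> E z y) \<longrightarrow> x = y)"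
  by (simp add: extensionality_def numeral_2_eq_2)

definition pairing :: form where
  "pairing = Forall (Forall (Exists (Forall (Iff (Mem 0 1) (Dis (Eq 0 3) (Eq 0 2))))))"

lemma sat_pairing:
  "sat E s pairing \<longleftrightarrow> (\<forall>x y. \<exists>z. \<forall>a. E a z \<longleftrightarrow> a = x \<or> a = y)"
  by (simp add: pairing_def numeral_2_eq_2 numeral_3_eq_3)

text \<open>
  In the instance given by \<open>p\<close>, index \<open>0\<close> of \<open>p\<close> is \<open>z\<close>, index \<open>1\<close> is \<open>x\<close>, and the higher indices
  are the other parameters; \<open>p\<close> has no index for \<open>y\<close>, hence \<open>y\<close> is not free in it. The renaming
  makes room for \<open>y\<close>.
\<close>

definition separation :: "form \<Rightarrow> form" where
  "separation p = Forall (Exists (Forall (Iff (Mem 0 1) (Con (Mem 0 2) (ren (up Suc) p)))))"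

lemma sat_separation:
  "sat E s (separation p) \<longleftrightarrow>
   (\<forall>x. \<exists>y. \<forall>z. E z y \<longleftrightarrow> E z x \<and> sat E (case_nat z (case_nat x s)) p)"
  by (simp add: separation_def numeral_2_eq_2)

text \<open>
  Here index \<open>0\<close> of \<open>p\<close> is \<open>z'\<close>, index \<open>1\<close> is \<open>z\<close>, index \<open>2\<close> is \<open>x\<close>, and the higher indices are
  the other parameters; again \<open>p\<close> has no index for \<open>y\<close>.
\<close>

definition replacement :: "form \<Rightarrow> form" where
  "replacement p =
     Forall (Imp (Forall (ExUnique p))
              (Exists (BAll 1 (BEx 1 (ren (up (up Suc)) p)))))"

lemma sat_replacement:
  "sat E s (replacement p) \<longleftrightarrow>
   (\<forall>x. (\<forall>z. \<exists>!z'. sat E (case_nat z' (case_nat z (case_nat x s))) p) \<longrightarrow>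
        (\<exists>y. \<forall>z. E z x \<longrightarrow>
           (\<exists>z'. E z' y \<and> sat E (case_nat z' (case_nat z (case_nat x s))) p)))"
  by (simp add: replacement_def)

text \<open>The universal closures of \<open>p\<close>, possibly with additional vacuous quantifiers.\<close>

definition closures :: "form \<Rightarrow> form set" where
  "closures p = {q. \<exists>n. q = (Forall ^^ n) p \<and> fv q = {}}"

definition axioms :: "form set" where
  "axioms = {extensionality, pairing}
     \<union> (\<Union>p\<in>{p. bounded p}. closures (separation p))
     \<union> (\<Union>p\<in>{p. bounded p}. closures (replacement p))"


section \<open>The axiom of choice and its variant\<close>

definition choice_set :: "nat \<Rightarrow> nat \<Rightarrow> form" where
  "choice_set y x =
     BAll x (Imp (Exists (Mem 0 1))
       (Exists (Con (Mem 0 1) (Con (Mem 0 (y + 2))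
         (Forall (Imp (Con (Mem 0 2) (Mem 0 (y + 3))) (Eq 0 1)))))))"

lemma sat_choice_set:
  "sat E s (choice_set y x) \<longleftrightarrow>
   (\<forall>z. E z (s x) \<longrightarrow> (\<exists>b. E b z) \<longrightarrow>
      (\<exists>a. E a z \<and> E a (s y) \<and> (\<forall>b. E b z \<and> E b (s y) \<longrightarrow> b = a)))"
  by (simp add: choice_set_def numeral_2_eq_2 numeral_3_eq_3)

definition AC_h1 :: "nat \<Rightarrow> form" where
  "AC_h1 x = BAll x (Exists (Mem 0 1))"

lemma sat_AC_h1:
  "sat E s (AC_h1 x) \<longleftrightarrow> (\<forall>z. E z (s x) \<longrightarrow> (\<exists>b. E b z))"
  by (simp add: AC_h1_def)

definition AC_h2 :: "nat \<Rightarrow> form" where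
  "AC_h2 x =
     BAll x (BAll (x + 1)
       (Imp (Neg (Eq 1 0)) (Neg (Exists (Con (Mem 0 2) (Mem 0 1))))))"

lemma sat_AC_h2:
  "sat E s (AC_h2 x) \<longleftrightarrow>
   (\<forall>z. E z (s x) \<longrightarrow> (\<forall>z'. E z' (s x) \<longrightarrow> z \<noteq> z' \<longrightarrow> \<not> (\<exists>a. E a z \<and> E a z')))"
  by (simp add: AC_h2_def numeral_2_eq_2)

definition AC_h_star :: "nat \<Rightarrow> form" where
  "AC_h_star x =
     BAll x (BEx 0 (BAll (x + 2) (Imp (Neg (Eq 2 0)) (Neg (Mem 1 0)))))"

lemma sat_AC_h_star:
  "sat E s (AC_h_star x) \<longleftrightarrow>
   (\<forall>z. E z (s x) \<longrightarrow> (\<exists>a. E a z \<and> (\<forall>z'. E z' (s x) \<longrightarrow> z \<noteq> z' \<longrightarrow> \<not> E a z')))"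
  by (simp add: AC_h_star_def numeral_2_eq_2)

definition AC :: form where
  "AC = Forall (Imp (Con (AC_h1 0) (AC_h2 0)) (Exists (choice_set 0 1)))"

lemma sat_AC:
  "sat E s AC \<longleftrightarrow>
   (\<forall>x. (\<forall>z. E z x \<longrightarrow> (\<exists>b. E b z)) \<and>
        (\<forall>z. E z x \<longrightarrow> (\<forall>z'. E z' x \<longrightarrow> z \<noteq> z' \<longrightarrow> \<not> (\<exists>a. E a z \<and> E a z'))) \<longrightarrow>
        (\<exists>y. \<forall>z. E z x \<longrightarrow> (\<exists>b. E b z) \<longrightarrow>
           (\<exists>a. E a z \<and> E a y \<and> (\<forall>b. E b z \<and> E b y \<longrightarrow> b = a))))"
  by (simp only: AC_def sat.simps sat_AC_h1 sat_AC_h2 sat_choice_set One_nat_def nat.case)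

definition AC_star :: form where
  "AC_star = Forall (Imp (AC_h_star 0) (Exists (Con (Neg (Mem 0 1)) (choice_set 0 1))))"

lemma sat_AC_star:
  "sat E s AC_star \<longleftrightarrow>
   (\<forall>x. (\<forall>z. E z x \<longrightarrow> (\<exists>a. E a z \<and> (\<forall>z'. E z' x \<longrightarrow> z \<noteq> z' \<longrightarrow> \<not> E a z'))) \<longrightarrow>
        (\<exists>y. \<not> E y x \<and>
           (\<forall>z. E z x \<longrightarrow> (\<exists>b. E b z) \<longrightarrow>
              (\<exists>a. E a z \<and> E a y \<and> (\<forall>b. E b z \<and> E b y \<longrightarrow> b = a)))))"
  by (simp only: AC_star_def sat.simps sat_Neg sat_AC_h_star sat_choice_set One_nat_def nat.case)

end

theory Submission
  imports Defs "HOL-Library.Countable"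
begin

text \<open>
  By completeness of the calculus it suffices to argue in a model. Let \<open>z*\<close> consist of the elements
  of \<open>z \<in> x\<close> that lie in no other member of \<open>x\<close>. Separation and Replacement yield
  \<open>X = {z* | z \<in> x}\<close>, whose members are non-empty and pairwise disjoint; let \<open>c\<close> be a choice set
  for \<open>X\<close>. Then \<open>d = c \<inter> \<Union>X\<close> is a choice set for \<open>x\<close>. If \<open>d \<in> x\<close>, then \<open>d = {a}\<close> and
  \<open>x = {{a}}\<close>, and \<open>{a, b}\<close> with any \<open>b \<noteq> a\<close> can be taken instead.
\<close>

section \<open>Renaming, weakening and compactness\<close>

lemma up_id: "up (\<lambda>n. n) = (\<lambda>n. n)"
  by (rule ext, case_tac n) auto

lemma ren_id [simp]: "ren (\<lambda>n. n) p = p"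
  by (induction p) (auto simp: up_id)

lemma up_comp: "up r (up r' n) = up (\<lambda>n. r (r' n)) n"
  by (cases n) auto

lemma ren_ren: "ren r (ren r' p) = ren (\<lambda>n. r (r' n)) p"
  by (induction p arbitrary: r r') (auto simp: up_comp)

lemma ren_cong: "(\<And>n. n \<in> fv p \<Longrightarrow> r n = r' n) \<Longrightarrow> ren r p = ren r' p"
proof (induction p arbitrary: r r')
  case (Forall p)
  have "up r n = up r' n" if "n \<in> fv p" for n
    using that Forall.prems by (cases n) auto
  then have "ren (up r) p = ren (up r') p" by (rule Forall.IH)
  then show ?case by simp
next
  case (Exists p)
  have "up r n = up r' n" if "n \<in> fv p" for n
    using that Exists.prems by (cases n) auto
  then have "ren (up r) p = ren (up r') p" by (rule Exists.IH)
  then show ?case by simp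
next
  case (Imp p q)
  from Imp.IH[of r r'] Imp.prems show ?case by simp
next
  case (Con p q)
  from Con.IH[of r r'] Con.prems show ?case by simp
next
  case (Dis p q)
  from Dis.IH[of r r'] Dis.prems show ?case by simp
qed auto

lemma finite_fv: "finite (fv p)"
proof (induction p)
  case (Forall p)
  then have "finite (Suc -` fv p)" by (intro finite_vimageI) auto
  then show ?case by (simp add: vimage_def)
next
  case (Exists p)
  then have "finite (Suc -` fv p)" by (intro finite_vimageI) auto
  then show ?case by (simp add: vimage_def)
qed auto

lemma inst_ren_up: "inst t (ren (up r) p) = ren (case_nat t r) p"
proof -
  have "(\<lambda>n. case_nat t (\<lambda>n. n) (up r n)) = case_nat t r"
    by (rule ext, case_tac n) auto
  then show ?thesis by (simp add: inst_def ren_ren)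
qed

lemma ren_inst: "ren r (inst t p) = inst (r t) (ren (up r) p)"
proof -
  have "(\<lambda>n. r (case_nat t (\<lambda>n. n) n)) = case_nat (r t) r"
    by (rule ext, case_tac n) auto
  then show ?thesis by (simp add: inst_ren_up) (simp add: inst_def ren_ren)
qed

lemma ren_up_lift: "ren (up r) (lift p) = lift (ren r p)"
  by (simp add: lift_def ren_ren)

text \<open>Index \<open>0\<close> is the eigenvariable below a new quantifier; instantiating the
  body, lifted past it, at this variable gives back the body. \<open>henkin_Forall\<close> relies on
  this.\<close>

lemma inst_0_ren_up_Suc: "inst 0 (ren (up Suc) p) = p"
proof -
  have "case_nat 0 Suc = (\<lambda>n. n)"
    by (rule ext, case_tac n) auto
  then show ?thesis by (simp add: inst_ren_up)
qed

lemma ren_Neg: "ren r (Neg p) = Neg (ren r p)"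
  by (simp add: Neg_def)

lemma inst_Neg: "inst t (Neg p) = Neg (inst t p)"
  by (simp add: inst_def ren_Neg)

lemma ren_image_lift: "ren (up r) ` lift ` H = lift ` ren r ` H"
  by (simp add: image_image ren_up_lift)

section \<open>Weakening and renaming of derivations\<close>

lemma provable_mono: "H \<turnstile> p \<Longrightarrow> H \<subseteq> H' \<Longrightarrow> H' \<turnstile> p"
proof (induction arbitrary: H' rule: provable.induct)
  case (Contr p H)
  show ?case by (rule provable.Contr, rule Contr.IH) (use Contr.prems in blast)
next
  case (ImpI p H q)
  show ?case by (rule provable.ImpI, rule ImpI.IH) (use ImpI.prems in blast)
next
  case (ImpE H p q)
  show ?case using ImpE.IH[OF ImpE.prems] by (rule provable.ImpE)
next
  case (ConE1 H p q)
  show ?case using ConE1.IH[OF ConE1.prems] by (rule provable.ConE1)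
next
  case (ConE2 H p q)
  show ?case using ConE2.IH[OF ConE2.prems] by (rule provable.ConE2)
next
  case (DisE H p q r)
  show ?case
  proof (rule provable.DisE)
    show "H' \<turnstile> Dis p q" using DisE.prems by (rule DisE.IH)
    show "insert p H' \<turnstile> r" by (rule DisE.IH) (use DisE.prems in blast)
    show "insert q H' \<turnstile> r" by (rule DisE.IH) (use DisE.prems in blast)
  qed
next
  case (AllI H p)
  show ?case by (rule provable.AllI, rule AllI.IH) (use AllI.prems in blast)
next
  case (ExE H p q)
  show ?case
  proof (rule provable.ExE)
    show "H' \<turnstile> Exists p" using ExE.prems by (rule ExE.IH)
    show "insert p (lift ` H') \<turnstile> lift q" by (rule ExE.IH) (use ExE.prems in blast)
  qed
next
  case (EqE H x y p)
  show ?case using EqE.IH[OF EqE.prems] by (rule provable.EqE)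
qed (auto intro: provable.intros)

text \<open>No injectivity is assumed: in the quantifier rules \<open>up r\<close> fixes the
  eigenvariable and commutes with \<open>lift\<close>.\<close>

lemma provable_ren: "H \<turnstile> p \<Longrightarrow> ren r ` H \<turnstile> ren r p"
proof (induction arbitrary: r rule: provable.induct)
  case (Contr p H)
  show ?case
    by (rule provable.Contr) (use Contr.IH[of r] in \<open>simp add: ren_Neg\<close>)
next
  case (ImpI p H q)
  then show ?case by (auto intro: provable.ImpI)
next
  case (ImpE H p q)
  then show ?case by (auto intro: provable.ImpE)
next
  case (ConE1 H p q)
  then show ?case by (auto intro: provable.ConE1)
next
  case (ConE2 H p q)
  then show ?case by (auto intro: provable.ConE2)
next
  case (DisE H p q s)
  show ?case
    by (rule provable.DisE[of _ "ren r p" "ren r q"]) (use DisE.IH[of r] in simp_all)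
next
  case (AllI H p)
  have "lift ` ren r ` H \<turnstile> ren (up r) p"
    using AllI.IH[of "up r"] by (simp only: ren_image_lift)
  then show ?case by (auto intro: provable.AllI)
next
  case (AllE H p t)
  have "ren r ` H \<turnstile> Forall (ren (up r) p)" using AllE.IH[of r] by simp
  then show ?case unfolding ren_inst by (rule provable.AllE)
next
  case (ExI H t p)
  have "ren r ` H \<turnstile> inst (r t) (ren (up r) p)" using ExI.IH[of r] by (simp only: ren_inst)
  then show ?case by (auto intro: provable.ExI)
next
  case (ExE H p q)
  show ?case
  proof (rule provable.ExE)
    show "ren r ` H \<turnstile> Exists (ren (up r) p)" using ExE.IH(1)[of r] by simp
    show "insert (ren (up r) p) (lift ` ren r ` H) \<turnstile> lift (ren r q)"
      using ExE.IH(2)[of "up r"] by (simp only: image_insert ren_image_lift ren_up_lift)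
  qed
next
  case (EqE H x y p)
  show ?case unfolding ren_inst
    by (rule provable.EqE[of _ "r x"])
      (use EqE.IH[of r] in \<open>simp_all only: ren_inst ren.simps\<close>)
qed (auto intro: provable.intros)

section \<open>Compactness of provability\<close>

lemma finite_subset_insert_split:
  assumes "finite F" "F \<subseteq> insert a B"
  obtains G where "finite G" "G \<subseteq> B" "F \<subseteq> insert a G"
  using assms by (intro that[of "F - {a}"]) auto

lemma provable_compact: "H \<turnstile> p \<Longrightarrow> \<exists>F. finite F \<and> F \<subseteq> H \<and> F \<turnstile> p"
proof (induction rule: provable.induct)
  case (Assm p H)
  then show ?case by (intro exI[of _ "{p}"]) (auto intro: provable.Assm)
next
  case (Contr p H)
  then obtain F where F: "finite F" "F \<subseteq> insert (Neg p) H" "F \<turnstile> Bot" by blast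
  from F(1,2) obtain G where "finite G" "G \<subseteq> H" "F \<subseteq> insert (Neg p) G"
    by (rule finite_subset_insert_split)
  with F(3) show ?case by (meson provable.Contr provable_mono)
next
  case (ImpI p H q)
  then obtain F where F: "finite F" "F \<subseteq> insert p H" "F \<turnstile> q" by blast
  from F(1,2) obtain G where "finite G" "G \<subseteq> H" "F \<subseteq> insert p G"
    by (rule finite_subset_insert_split)
  with F(3) show ?case by (meson provable.ImpI provable_mono)
next
  case (ImpE H p q)
  then obtain F G where FG: "finite F" "F \<subseteq> H" "F \<turnstile> Imp p q" "finite G" "G \<subseteq> H" "G \<turnstile> p" by blast
  have "F \<union> G \<turnstile> q"
    using provable_mono[OF FG(3), of "F \<union> G"] provable_mono[OF FG(6), of "F \<union> G"]
    by (auto intro: provable.ImpE)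
  with FG show ?case by (intro exI[of _ "F \<union> G"]) auto
next
  case (ConI H p q)
  then obtain F G where FG: "finite F" "F \<subseteq> H" "F \<turnstile> p" "finite G" "G \<subseteq> H" "G \<turnstile> q" by blast
  have "F \<union> G \<turnstile> Con p q"
    using provable_mono[OF FG(3), of "F \<union> G"] provable_mono[OF FG(6), of "F \<union> G"]
    by (auto intro: provable.ConI)
  with FG show ?case by (intro exI[of _ "F \<union> G"]) auto
next
  case (EqE H x y p)
  then obtain F G where FG: "finite F" "F \<subseteq> H" "F \<turnstile> Eq x y" "finite G" "G \<subseteq> H" "G \<turnstile> inst x p" by blast
  have "F \<union> G \<turnstile> inst y p"
    using provable_mono[OF FG(3), of "F \<union> G"] provable_mono[OF FG(6), of "F \<union> G"]
    by (auto intro: provable.EqE)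
  with FG show ?case by (intro exI[of _ "F \<union> G"]) auto
next
  case (DisE H p q r)
  then obtain F1 F2 F3 where F: "finite F1" "F1 \<subseteq> H" "F1 \<turnstile> Dis p q"
    "finite F2" "F2 \<subseteq> insert p H" "F2 \<turnstile> r" "finite F3" "F3 \<subseteq> insert q H" "F3 \<turnstile> r" by blast
  from F(4,5) obtain G2 where G2: "finite G2" "G2 \<subseteq> H" "F2 \<subseteq> insert p G2"
    by (rule finite_subset_insert_split)
  from F(7,8) obtain G3 where G3: "finite G3" "G3 \<subseteq> H" "F3 \<subseteq> insert q G3"
    by (rule finite_subset_insert_split)
  let ?G = "F1 \<union> G2 \<union> G3"
  have "?G \<turnstile> r"
  proof (rule provable.DisE)
    show "?G \<turnstile> Dis p q" using F(3) by (rule provable_mono) auto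
    show "insert p ?G \<turnstile> r" using F(6) by (rule provable_mono) (use G2 in auto)
    show "insert q ?G \<turnstile> r" using F(9) by (rule provable_mono) (use G3 in auto)
  qed
  with F G2 G3 show ?case by (intro exI[of _ ?G]) auto
next
  case (AllI H p)
  then obtain F where F: "finite F" "F \<subseteq> lift ` H" "F \<turnstile> p" by blast
  then obtain G where "finite G" "G \<subseteq> H" "F = lift ` G" by (meson finite_subset_image)
  with F(3) show ?case by (auto intro: provable.AllI)
next
  case (ExE H p q)
  then obtain F1 F2 where F: "finite F1" "F1 \<subseteq> H" "F1 \<turnstile> Exists p"
    "finite F2" "F2 \<subseteq> insert p (lift ` H)" "F2 \<turnstile> lift q" by blast
  from F(4,5) obtain G2 where G2: "finite G2" "G2 \<subseteq> lift ` H" "F2 \<subseteq> insert p G2"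
    by (rule finite_subset_insert_split)
  then obtain G where G: "finite G" "G \<subseteq> H" "G2 = lift ` G" by (meson finite_subset_image)
  have "F1 \<union> G \<turnstile> q"
  proof (rule provable.ExE)
    show "F1 \<union> G \<turnstile> Exists p" using F(3) by (rule provable_mono) auto
    show "insert p (lift ` (F1 \<union> G)) \<turnstile> lift q"
      using F(6) by (rule provable_mono) (use G G2 in auto)
  qed
  with F G show ?case by (intro exI[of _ "F1 \<union> G"]) auto
qed (blast intro: provable.intros)+

section \<open>Henkin completeness\<close>

lemma provable_cut: "H \<turnstile> p \<Longrightarrow> insert p H \<turnstile> q \<Longrightarrow> H \<turnstile> q"
  by (meson ImpI ImpE)

text \<open>A variable that occurs in neither \<open>H\<close> nor \<open>Exists q\<close> can play
  the eigenvariable of \<open>ExE\<close>.\<close>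

lemma inconsistent_witness:
  assumes "insert (inst t q) H \<turnstile> Bot" "t \<notin> fv (Exists q)" "\<And>p. p \<in> H \<Longrightarrow> t \<notin> fv p"
  shows "insert (Exists q) H \<turnstile> Bot"
proof -
  \<comment> \<open>\<open>r\<close> moves \<open>t\<close> to the eigenvariable \<open>0\<close>
    and shifts all other variables. So it agrees with \<open>lift\<close> on formulas without
    \<open>t\<close> and turns \<open>inst t q\<close> back into \<open>q\<close>.\<close>
  define r where "r n = (if n = t then 0 else Suc n)" for n
  have lift: "ren r p = lift p" if "t \<notin> fv p" for p
    unfolding lift_def using that by (intro ren_cong) (auto simp: r_def)
  have "ren r (inst t q) = ren (\<lambda>n. n) q"
    unfolding inst_def ren_ren
    by (rule ren_cong) (use assms(2) in \<open>auto simp: r_def split: nat.split\<close>)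
  then have "insert q (lift ` H) \<turnstile> Bot"
    using provable_ren[OF assms(1), of r] assms(3) by (simp add: lift cong: image_cong)
  then have "insert q (lift ` insert (Exists q) H) \<turnstile> Bot"
    by (rule provable_mono) auto
  then have "insert q (lift ` insert (Exists q) H) \<turnstile> lift Bot"
    by (simp add: lift_def)
  then show ?thesis
    by (rule ExE[rotated]) (simp add: Assm)
qed

text \<open>The infinitely many variables not occurring in \<open>H\<close> serve as Henkin constants.\<close>

definition extendable :: "form set \<Rightarrow> bool" where
  "extendable H \<longleftrightarrow> \<not> H \<turnstile> Bot \<and> infinite (- (\<Union>(fv ` H)))"

text \<open>A single formula has only finitely many free variables.\<close>

lemma infinite_unused_insert:
  "infinite (- (\<Union>(fv ` H))) \<Longrightarrow> infinite (- (\<Union>(fv ` insert p H)))"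
  using Diff_infinite_finite[OF finite_fv[of p], of "- (\<Union>(fv ` H))"]
  by (simp add: Diff_eq Int_commute)

lemma extendable_step:
  assumes "extendable H"
  shows "\<exists>H'. extendable H' \<and> H \<subseteq> H' \<and>
    (insert p H' \<turnstile> Bot \<or> p \<in> H' \<and> (\<forall>q. p = Exists q \<longrightarrow> (\<exists>t. inst t q \<in> H')))"
proof (cases "insert p H \<turnstile> Bot")
  case True
  with assms show ?thesis by blast
next
  case con: False
  have inf: "infinite (- (\<Union>(fv ` insert p H)))"
    using assms by (intro infinite_unused_insert) (simp add: extendable_def)
  show ?thesis
  proof (cases "\<exists>q. p = Exists q")
    case False
    with con inf show ?thesis
      by (intro exI[of _ "insert p H"]) (auto simp: extendable_def)
  next
    case True
    then obtain q where q: "p = Exists q" by blast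
    obtain t where t: "t \<in> - (\<Union>(fv ` insert p H))"
      using infinite_imp_nonempty[OF inf] by blast
    let ?H = "insert (inst t q) (insert p H)"
    have "\<not> ?H \<turnstile> Bot"
    proof
      assume "?H \<turnstile> Bot"
      then have "insert (Exists q) (insert p H) \<turnstile> Bot"
        by (rule inconsistent_witness) (use t q in auto)
      with con q show False by simp
    qed
    moreover have "infinite (- (\<Union>(fv ` ?H)))"
      using inf by (rule infinite_unused_insert)
    ultimately show ?thesis
      using q by (intro exI[of _ ?H]) (auto simp: extendable_def)
  qed
qed

text \<open>Provides the enumeration of all formulas; stage \<open>n\<close> of the construction
  treats \<open>from_nat n\<close>.\<close>

instance form :: countable
  by countable_datatype

text \<open>A maximal consistent set with the witness property; deductive closure is derived in
  \<open>henkin_mem\<close>.\<close>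

definition henkin :: "form set \<Rightarrow> bool" where
  "henkin M \<longleftrightarrow> \<not> M \<turnstile> Bot \<and> (\<forall>p. p \<in> M \<or> insert p M \<turnstile> Bot) \<and>
     (\<forall>q. Exists q \<in> M \<longrightarrow> (\<exists>t. inst t q \<in> M))"

text \<open>\<open>M\<close> is the union of a chain of extendable sets. Each stage keeps infinitely
  many variables in reserve for later witnesses; the union may use up all of them.\<close>

lemma henkin_extension:
  assumes "extendable H"
  obtains M where "H \<subseteq> M" "henkin M"
proof -
  let ?Q = "\<lambda>n S S'. S \<subseteq> S' \<and> (insert (from_nat n) S' \<turnstile> Bot \<or> from_nat n \<in> S' \<and>
    (\<forall>q. from_nat n = Exists q \<longrightarrow> (\<exists>t. inst t q \<in> S')))"
  \<comment> \<open>Dependent choice only guarantees the invariant at \<open>0\<close>, so the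
    clause for \<open>n = 0\<close> is what makes the chain start above \<open>H\<close>.\<close>
  have "\<exists>f. \<forall>n. (extendable (f n) \<and> (n = 0 \<longrightarrow> H \<subseteq> f n)) \<and> ?Q n (f n) (f (Suc n))"
  proof (rule dependent_nat_choice[where P = "\<lambda>n S. extendable S \<and> (n = 0 \<longrightarrow> H \<subseteq> S)" and Q = ?Q])
    fix S and n :: nat
    assume "extendable S \<and> (n = 0 \<longrightarrow> H \<subseteq> S)"
    then show "\<exists>S'. (extendable S' \<and> (Suc n = 0 \<longrightarrow> H \<subseteq> S')) \<and> ?Q n S S'"
      using extendable_step[of S "from_nat n"] by simp
  qed (use assms in blast)
  then obtain f where f: "\<forall>n. (extendable (f n) \<and> (n = 0 \<longrightarrow> H \<subseteq> f n)) \<and> ?Q n (f n) (f (Suc n))" ..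
  have f0: "H \<subseteq> f 0" using f[THEN spec, of 0] by simp
  have ext: "extendable (f n)" for n using f[THEN spec, of n] by simp
  have step: "?Q n (f n) (f (Suc n))" for n using f[THEN spec, of n] by simp
  have mono: "mono f" unfolding mono_iff_le_Suc using step by simp
  define M where "M = (\<Union>n. f n)"
  have sub: "f n \<subseteq> M" for n by (auto simp: M_def)
  have finite_sub: "\<exists>n. F \<subseteq> f n" if "finite F" "F \<subseteq> M" for F
    using that
  proof induction
    case (insert p F)
    then obtain m n where "F \<subseteq> f m" "p \<in> f n" by (auto simp: M_def)
    then have "insert p F \<subseteq> f (max m n)"
      using monoD[OF mono, of m "max m n"] monoD[OF mono, of n "max m n"] by auto
    then show ?case by blast
  qed simp
  \<comment> \<open>By compactness a contradiction in \<open>M\<close> would already occur in a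
    single stage.\<close>
  have con: "\<not> M \<turnstile> Bot"
  proof
    assume "M \<turnstile> Bot"
    then obtain F where F: "finite F" "F \<subseteq> M" "F \<turnstile> Bot" using provable_compact by blast
    then obtain n where "F \<subseteq> f n" using finite_sub by blast
    with F(3) have "f n \<turnstile> Bot" by (rule provable_mono)
    with ext[of n] show False by (simp add: extendable_def)
  qed
  have decide: "insert p M \<turnstile> Bot \<or> p \<in> M \<and> (\<forall>q. p = Exists q \<longrightarrow> (\<exists>t. inst t q \<in> M))" for p
  proof (cases "insert p (f (Suc (to_nat p))) \<turnstile> Bot")
    case True
    then have "insert p M \<turnstile> Bot" by (rule provable_mono) (use sub in blast)
    then show ?thesis ..
  next
    case False
    with step[of "to_nat p"] obtain m where
      "p \<in> f m" "\<forall>q. p = Exists q \<longrightarrow> (\<exists>t. inst t q \<in> f m)" by auto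
    with sub[of m] show ?thesis by blast
  qed
  \<comment> \<open>As \<open>Exists q\<close> is already in \<open>M\<close>, inserting it changes
    nothing, and the first alternative of \<open>decide\<close> contradicts
    \<open>con\<close>.\<close>
  have "\<exists>t. inst t q \<in> M" if "Exists q \<in> M" for q
    using decide[of "Exists q"] con that by (auto simp: insert_absorb)
  with con decide have "henkin M" by (simp add: henkin_def) blast
  moreover have "H \<subseteq> M" using f0 sub[of 0] by simp
  ultimately show ?thesis by (intro that)
qed

section \<open>Henkin sets decide formulas as a model does\<close>

context
  fixes M assumes henkin: "henkin M"
begin

lemma henkin_consistent: "\<not> M \<turnstile> Bot"
  using henkin by (simp add: henkin_def)

lemma henkin_inconsistent: "p \<notin> M \<Longrightarrow> insert p M \<turnstile> Bot"
  using henkin by (auto simp: henkin_def)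

text \<open>If \<open>M\<close> proved a formula outside \<open>M\<close>, a cut would make
  \<open>M\<close> inconsistent.\<close>

lemma henkin_mem: "p \<in> M \<longleftrightarrow> M \<turnstile> p"
  using Assm[of p M] provable_cut[of M p Bot] henkin_inconsistent henkin_consistent by blast

lemma henkin_Bot: "Bot \<notin> M"
  using henkin_consistent by (simp add: henkin_mem)

text \<open>Ex falso, obtained from \<open>Contr\<close> after weakening by
  \<open>Neg q\<close>.\<close>

lemma henkin_notin: "p \<notin> M \<Longrightarrow> insert p M \<turnstile> q"
  using henkin_inconsistent provable_mono[of "insert p M" Bot "insert (Neg q) (insert p M)"]
  by (auto intro: Contr)

lemma henkin_Imp: "Imp p q \<in> M \<longleftrightarrow> (p \<in> M \<longrightarrow> q \<in> M)"
proof
  assume "Imp p q \<in> M"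
  then show "p \<in> M \<longrightarrow> q \<in> M" using ImpE[of M p q] by (simp add: henkin_mem)
next
  assume *: "p \<in> M \<longrightarrow> q \<in> M"
  have "insert p M \<turnstile> q"
  proof (cases "p \<in> M")
    case True
    with * show ?thesis by (simp add: Assm)
  qed (rule henkin_notin)
  then show "Imp p q \<in> M" by (simp add: henkin_mem ImpI)
qed

lemma henkin_Neg: "Neg p \<in> M \<longleftrightarrow> p \<notin> M"
  by (simp add: Neg_def henkin_Imp henkin_Bot)

lemma henkin_Con: "Con p q \<in> M \<longleftrightarrow> p \<in> M \<and> q \<in> M"
  using ConI[of M p q] ConE1[of M p q] ConE2[of M p q] by (auto simp: henkin_mem)

lemma henkin_Dis: "Dis p q \<in> M \<longleftrightarrow> p \<in> M \<or> q \<in> M"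
proof
  assume "Dis p q \<in> M"
  then have "M \<turnstile> Dis p q" by (rule Assm)
  then show "p \<in> M \<or> q \<in> M"
    using DisE[of M p q Bot] henkin_inconsistent henkin_consistent by blast
next
  assume "p \<in> M \<or> q \<in> M"
  then show "Dis p q \<in> M"
    using DisI1[of M p q] DisI2[of M q p] by (auto simp: henkin_mem)
qed

lemma henkin_Exists: "Exists p \<in> M \<longleftrightarrow> (\<exists>t. inst t p \<in> M)"
proof
  assume "Exists p \<in> M"
  with henkin show "\<exists>t. inst t p \<in> M" by (simp add: henkin_def)
next
  assume "\<exists>t. inst t p \<in> M"
  then obtain t where "M \<turnstile> inst t p" by (auto simp: henkin_mem)
  then show "Exists p \<in> M" unfolding henkin_mem by (rule ExI)
qed

text \<open>The witness property speaks of existentials only, so the converse goes through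
  \<open>Exists (Neg p)\<close>. If all instances of \<open>p\<close> are in \<open>M\<close>, its
  negation is in \<open>M\<close>; below the eigenvariable, \<open>Neg p\<close> would yield the
  lifted existential with witness \<open>0\<close>.\<close>

lemma henkin_Forall: "Forall p \<in> M \<longleftrightarrow> (\<forall>t. inst t p \<in> M)"
proof
  assume "Forall p \<in> M"
  then show "\<forall>t. inst t p \<in> M" using AllE[of M p] by (simp add: henkin_mem)
next
  assume inst: "\<forall>t. inst t p \<in> M"
  let ?N = "Neg (Exists (Neg p))"
  have "?N \<in> M" using inst by (simp add: henkin_Neg henkin_Exists inst_Neg)
  then have N: "lift ?N \<in> lift ` M" by (rule imageI)
  let ?H = "insert (Neg p) (lift ` M)"
  have "?H \<turnstile> Imp (Exists (ren (up Suc) (Neg p))) Bot"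
    using N by (intro Assm) (simp add: lift_def Neg_def)
  moreover have "?H \<turnstile> Exists (ren (up Suc) (Neg p))"
    by (rule ExI[of _ 0]) (simp add: inst_0_ren_up_Suc Assm)
  ultimately have "?H \<turnstile> Bot" by (rule ImpE)
  then show "Forall p \<in> M" unfolding henkin_mem by (rule AllI[OF Contr])
qed

lemma henkin_refl: "Eq x x \<in> M"
  by (simp add: henkin_mem EqI)

lemma henkin_subst: "Eq x y \<in> M \<Longrightarrow> inst x p \<in> M \<Longrightarrow> inst y p \<in> M"
  using EqE[of M x y p] by (simp add: henkin_mem)

text \<open>Leibniz's rule for the property of being equal to \<open>x\<close>; \<open>Suc x\<close>
  is \<open>x\<close> seen from below the binder.\<close>

lemma henkin_sym: "Eq x y \<in> M \<Longrightarrow> Eq y x \<in> M"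
  using henkin_subst[of x y "Eq 0 (Suc x)"] henkin_refl by (simp add: inst_def)

lemma henkin_trans: "Eq x y \<in> M \<Longrightarrow> Eq y z \<in> M \<Longrightarrow> Eq x z \<in> M"
  using henkin_subst[of y z "Eq (Suc x) 0"] by (simp add: inst_def)

lemma henkin_Mem_cong:
  assumes "Eq x x' \<in> M" "Eq y y' \<in> M" "Mem x y \<in> M"
  shows "Mem x' y' \<in> M"
proof -
  have "Mem x' y \<in> M" using henkin_subst[of x x' "Mem 0 (Suc y)"] assms by (simp add: inst_def)
  then show ?thesis using henkin_subst[of y y' "Mem (Suc x') 0"] assms by (simp add: inst_def)
qed

end

text \<open>
  The domain is a set rather than a type, because the term model is a quotient that depends on the
  chosen Henkin set.
\<close>

fun sat_in :: "'a set \<Rightarrow> ('a \<Rightarrow> 'a \<Rightarrow> bool) \<Rightarrow> (nat \<Rightarrow> 'a) \<Rightarrow> form \<Rightarrow> bool" where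
  "sat_in D E s Bot = False"
| "sat_in D E s (Eq x y) = (s x = s y)"
| "sat_in D E s (Mem x y) = E (s x) (s y)"
| "sat_in D E s (Imp p q) = (sat_in D E s p \<longrightarrow> sat_in D E s q)"
| "sat_in D E s (Con p q) = (sat_in D E s p \<and> sat_in D E s q)"
| "sat_in D E s (Dis p q) = (sat_in D E s p \<or> sat_in D E s q)"
| "sat_in D E s (Forall p) = (\<forall>a\<in>D. sat_in D E (case_nat a s) p)"
| "sat_in D E s (Exists p) = (\<exists>a\<in>D. sat_in D E (case_nat a s) p)"

text \<open>The term model: variables modulo the equalities in \<open>M\<close>. Its domain is
  \<open>range s\<close>, so every element is named by a variable and the quantifiers range over the
  instances.\<close>

lemma henkin_model:
  assumes "henkin M"
  obtains D :: "nat set set" and E s where "range s \<subseteq> D" "\<And>p. sat_in D E s p \<longleftrightarrow> p \<in> M"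
proof -
  note [simp] = henkin_Bot[OF assms] henkin_Imp[OF assms] henkin_Con[OF assms] henkin_Dis[OF assms]
    henkin_Exists[OF assms] henkin_Forall[OF assms]
  define s where "s x = {y. Eq x y \<in> M}" for x
  define E where "E A B \<longleftrightarrow> (\<exists>x y. A = s x \<and> B = s y \<and> Mem x y \<in> M)" for A B
  have s_eq: "s x = s y \<longleftrightarrow> Eq x y \<in> M" for x y
    unfolding s_def using henkin_refl[OF assms] henkin_sym[OF assms] henkin_trans[OF assms] by blast
  have E_s: "E (s x) (s y) \<longleftrightarrow> Mem x y \<in> M" for x y
    unfolding E_def s_eq using henkin_Mem_cong[OF assms] henkin_refl[OF assms] henkin_sym[OF assms]
    by blast
  have s_case: "case_nat (s t) (\<lambda>n. s (r n)) = (\<lambda>n. s (case_nat t r n))" for t r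
    by (rule ext, case_tac n) auto
  \<comment> \<open>The truth lemma needs all renamings at once: an instance of a quantified body is
    the body renamed by \<open>case_nat t r\<close>, to which the induction hypothesis
    applies.\<close>
  have "sat_in (range s) E (\<lambda>n. s (r n)) p \<longleftrightarrow> ren r p \<in> M" for r p
    by (induction p arbitrary: r) (auto simp: s_eq E_s s_case inst_ren_up)
  from this[of "\<lambda>n. n"] show ?thesis by (intro that[of s "range s" E]) auto
qed

text \<open>If \<open>p\<close> is unprovable, then \<open>Neg p\<close> is consistent with
  \<open>H\<close> by \<open>Contr\<close>, and the term model of a Henkin extension refutes
  \<open>p\<close>. Variables are natural numbers, so their classes have type
  \<open>nat set\<close>.\<close>

theorem completeness:
  assumes "infinite (- (\<Union>(fv ` H)))"
    and "\<And>(D :: nat set set) E s. range s \<subseteq> D \<Longrightarrow> \<forall>q\<in>H. sat_in D E s q \<Longrightarrow> sat_in D E s p"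
  shows "H \<turnstile> p"
proof (rule ccontr)
  assume "\<not> H \<turnstile> p"
  then have "extendable (insert (Neg p) H)"
    using Contr infinite_unused_insert[OF assms(1)] unfolding extendable_def by blast
  then obtain M where M: "insert (Neg p) H \<subseteq> M" "henkin M"
    by (rule henkin_extension)
  obtain D :: "nat set set" and E s where D: "range s \<subseteq> D" "\<And>q. sat_in D E s q \<longleftrightarrow> q \<in> M"
    by (rule henkin_model[OF M(2)], rule that)
  have "sat_in D E s p" using D(1) by (rule assms(2)) (use M(1) D(2) in auto)
  moreover have "p \<notin> M" using M by (simp add: henkin_Neg)
  ultimately show False using D(2) by simp
qed

section \<open>The derivation in a model\<close>

lemma sat_in_Neg [simp]: "sat_in D E s (Neg p) = (\<not> sat_in D E s p)"
  by (simp add: Neg_def)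

lemma sat_in_Iff [simp]: "sat_in D E s (Iff p q) = (sat_in D E s p \<longleftrightarrow> sat_in D E s q)"
  by (auto simp: Iff_def)

lemma sat_in_BAll [simp]:
  "sat_in D E s (BAll v p) = (\<forall>u\<in>D. E u (s v) \<longrightarrow> sat_in D E (case_nat u s) p)"
  by (simp add: BAll_def)

lemma sat_in_BEx [simp]:
  "sat_in D E s (BEx v p) = (\<exists>u\<in>D. E u (s v) \<and> sat_in D E (case_nat u s) p)"
  by (simp add: BEx_def)

lemma sat_in_ren: "sat_in D E s (ren r p) = sat_in D E (\<lambda>n. s (r n)) p"
  by (induction p arbitrary: s r) (auto simp: case_nat_up)

lemma sat_in_ExUnique [simp]:
  "sat_in D E s (ExUnique p) \<longleftrightarrow>
   (\<exists>a\<in>D. sat_in D E (case_nat a s) p \<and> (\<forall>b\<in>D. sat_in D E (case_nat b s) p \<longrightarrow> b = a))"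
  by (simp add: ExUnique_def sat_in_ren case_nat_up)

text \<open>Makes the truth value of a sentence independent of the assignment.\<close>

lemma sat_in_cong:
  "(\<And>n. n \<in> fv p \<Longrightarrow> s n = s' n) \<Longrightarrow> sat_in D E s p = sat_in D E s' p"
proof (induction p arbitrary: s s')
  case (Forall p)
  have "sat_in D E (case_nat a s) p = sat_in D E (case_nat a s') p" for a
    by (rule Forall.IH) (use Forall.prems in \<open>auto split: nat.split\<close>)
  then show ?case by simp
next
  case (Exists p)
  have "sat_in D E (case_nat a s) p = sat_in D E (case_nat a s') p" for a
    by (rule Exists.IH) (use Exists.prems in \<open>auto split: nat.split\<close>)
  then show ?case by simp
next
  case (Imp p q)
  from Imp.IH[of s s'] Imp.prems show ?case by simp
next
  case (Con p q)
  from Con.IH[of s s'] Con.prems show ?case by simp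
next
  case (Dis p q)
  from Dis.IH[of s s'] Dis.prems show ?case by simp
qed auto

section \<open>Universal closures and the axioms in a model\<close>

lemma fv_Forall_power: "fv ((Forall ^^ n) p) = {k. k + n \<in> fv p}"
  by (induction n) auto

text \<open>Quantifying as often as a strict bound on the free variables leaves none of them
  free.\<close>

lemma closures_nonempty: "\<exists>n. (Forall ^^ n) p \<in> closures p"
proof -
  obtain n where "\<forall>k\<in>fv p. k < n"
    using finite_fv[of p] by (auto simp: finite_nat_set_iff_bounded)
  then have "fv ((Forall ^^ n) p) = {}" by (force simp: fv_Forall_power)
  then show ?thesis by (auto simp: closures_def)
qed

text \<open>Strips one quantifier at a time: an assignment is its shifted tail extended by its value
  at \<open>0\<close>. The premise must cover all assignments because the tail is a different
  one.\<close>

lemma sat_in_Forall_power: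
  "(\<And>s. range s \<subseteq> D \<Longrightarrow> sat_in D E s ((Forall ^^ n) p)) \<Longrightarrow> range s \<subseteq> D \<Longrightarrow> sat_in D E s p"
proof (induction n arbitrary: s)
  case (Suc n)
  show ?case
  proof (rule Suc.IH)
    fix s :: "nat \<Rightarrow> 'a"
    assume s: "range s \<subseteq> D"
    then have "sat_in D E (\<lambda>k. s (Suc k)) ((Forall ^^ Suc n) p)" by (intro Suc.prems) auto
    with s have "sat_in D E (case_nat (s 0) (\<lambda>k. s (Suc k))) ((Forall ^^ n) p)" by auto
    moreover have "case_nat (s 0) (\<lambda>k. s (Suc k)) = s" by (rule ext, case_tac x) auto
    ultimately show "sat_in D E s ((Forall ^^ n) p)" by simp
  qed (fact Suc.prems)
qed simp

text \<open>The axioms contain schemes only in closed form; this recovers an instance for arbitrary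
  parameters, namely the values of \<open>s'\<close>.\<close>

lemma sat_in_closures:
  assumes "\<forall>q\<in>closures p. sat_in D E s q" "range s' \<subseteq> D"
  shows "sat_in D E s' p"
proof -
  obtain n where n: "(Forall ^^ n) p \<in> closures p" using closures_nonempty by blast
  have "sat_in D E t ((Forall ^^ n) p)" for t
    using assms(1) n sat_in_cong[of "(Forall ^^ n) p" s t] by (auto simp: closures_def)
  from sat_in_Forall_power[OF this assms(2)] show ?thesis .
qed

lemma sat_in_separation:
  assumes "\<forall>q\<in>axioms. sat_in D E s q" "range s' \<subseteq> D" "bounded p" "x \<in> D"
  shows "\<exists>y\<in>D. \<forall>z\<in>D. E z y \<longleftrightarrow> E z x \<and> sat_in D E (case_nat z (case_nat x s')) p"
proof -
  have "sat_in D E s' (separation p)"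
    by (rule sat_in_closures[OF _ assms(2)]) (use assms(1,3) in \<open>auto simp: axioms_def\<close>)
  with assms(4) show ?thesis
    by (simp add: separation_def sat_in_ren case_nat_up numeral_2_eq_2)
qed

lemma sat_in_replacement:
  assumes "\<forall>q\<in>axioms. sat_in D E s q" "range s' \<subseteq> D" "bounded p" "x \<in> D"
    and "\<And>z. z \<in> D \<Longrightarrow> \<exists>a\<in>D. sat_in D E (case_nat a (case_nat z (case_nat x s'))) p \<and>
      (\<forall>b\<in>D. sat_in D E (case_nat b (case_nat z (case_nat x s'))) p \<longrightarrow> b = a)"
  shows "\<exists>y\<in>D. \<forall>z\<in>D. E z x \<longrightarrow>
    (\<exists>a\<in>D. E a y \<and> sat_in D E (case_nat a (case_nat z (case_nat x s'))) p)"
proof -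
  have "sat_in D E s' (replacement p)"
    by (rule sat_in_closures[OF _ assms(2)]) (use assms(1,3) in \<open>auto simp: axioms_def\<close>)
  with assms(4,5) show ?thesis
    by (simp add: replacement_def sat_in_ren case_nat_up)
qed

lemma sat_in_extensionality:
  assumes "\<forall>q\<in>axioms. sat_in D E s q" "x \<in> D" "y \<in> D" "\<And>z. z \<in> D \<Longrightarrow> E z x \<longleftrightarrow> E z y"
  shows "x = y"
proof -
  have "sat_in D E s extensionality" using assms(1) by (simp add: axioms_def)
  with assms(2-4) show ?thesis by (simp add: extensionality_def numeral_2_eq_2)
qed

lemma sat_in_pairing:
  assumes "\<forall>q\<in>axioms. sat_in D E s q" "x \<in> D" "y \<in> D"
  shows "\<exists>z\<in>D. \<forall>a\<in>D. E a z \<longleftrightarrow> a = x \<or> a = y"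
proof -
  have "sat_in D E s pairing" using assms(1) by (simp add: axioms_def)
  with assms(2,3) show ?thesis by (simp add: pairing_def numeral_2_eq_2 numeral_3_eq_3)
qed

section \<open>Formulas for the elements private to one member\<close>

definition private_elem :: "nat \<Rightarrow> nat \<Rightarrow> nat \<Rightarrow> form" where
  "private_elem a z x = BAll x (Imp (Neg (Eq (z + 1) 0)) (Neg (Mem (a + 1) 0)))"

text \<open>In the notation of the introduction, \<open>private_part u z x\<close> states \<open>u = z*\<close>.\<close>

definition private_part :: "nat \<Rightarrow> nat \<Rightarrow> nat \<Rightarrow> form" where
  "private_part u z x =
     Con (BAll u (Con (Mem 0 (z + 1)) (private_elem 0 (z + 1) (x + 1))))
       (BAll z (Imp (private_elem 0 (z + 1) (x + 1)) (Mem 0 (u + 1))))"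

lemma bounded_private_elem: "bounded (private_elem a z x)"
  unfolding private_elem_def Neg_def by (intro bounded.intros)

text \<open>Admits the formula to both schemes; hence \<open>private_part\<close> consists of two
  bounded inclusions instead of one unbounded equivalence.\<close>

lemma bounded_private_part: "bounded (private_part u z x)"
  unfolding private_part_def by (intro bounded.intros bounded_private_elem)

lemma sat_in_private_elem:
  "sat_in D E s (private_elem a z x) \<longleftrightarrow> (\<forall>w\<in>D. E w (s x) \<longrightarrow> s z \<noteq> w \<longrightarrow> \<not> E (s a) w)"
  by (simp add: private_elem_def)

lemma sat_in_private_part:
  "sat_in D E s (private_part u z x) \<longleftrightarrow>
   (\<forall>a\<in>D. E a (s u) \<longleftrightarrow> E a (s z) \<and> (\<forall>w\<in>D. E w (s x) \<longrightarrow> s z \<noteq> w \<longrightarrow> \<not> E a w))"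
  by (auto simp: private_part_def sat_in_private_elem)

section \<open>The choice principles in a model\<close>

lemma sat_in_choice_set:
  "sat_in D E s (choice_set y x) \<longleftrightarrow>
   (\<forall>z\<in>D. E z (s x) \<longrightarrow> (\<exists>b\<in>D. E b z) \<longrightarrow>
      (\<exists>a\<in>D. E a z \<and> E a (s y) \<and> (\<forall>b\<in>D. E b z \<and> E b (s y) \<longrightarrow> b = a)))"
  by (simp add: choice_set_def numeral_2_eq_2 numeral_3_eq_3)

lemma sat_in_AC_h1:
  "sat_in D E s (AC_h1 x) \<longleftrightarrow> (\<forall>z\<in>D. E z (s x) \<longrightarrow> (\<exists>b\<in>D. E b z))"
  by (simp add: AC_h1_def)

lemma sat_in_AC_h2:
  "sat_in D E s (AC_h2 x) \<longleftrightarrow>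
   (\<forall>z\<in>D. E z (s x) \<longrightarrow> (\<forall>z'\<in>D. E z' (s x) \<longrightarrow> z \<noteq> z' \<longrightarrow> \<not> (\<exists>a\<in>D. E a z \<and> E a z')))"
  by (simp add: AC_h2_def numeral_2_eq_2)

lemma sat_in_AC_h_star:
  "sat_in D E s (AC_h_star x) \<longleftrightarrow>
   (\<forall>z\<in>D. E z (s x) \<longrightarrow>
     (\<exists>a\<in>D. E a z \<and> (\<forall>z'\<in>D. E z' (s x) \<longrightarrow> z \<noteq> z' \<longrightarrow> \<not> E a z')))"
  by (simp add: AC_h_star_def numeral_2_eq_2)

lemma sat_in_AC:
  "sat_in D E s AC \<longleftrightarrow>
   (\<forall>x\<in>D. (\<forall>z\<in>D. E z x \<longrightarrow> (\<exists>b\<in>D. E b z)) \<and>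
        (\<forall>z\<in>D. E z x \<longrightarrow> (\<forall>z'\<in>D. E z' x \<longrightarrow> z \<noteq> z' \<longrightarrow> \<not> (\<exists>a\<in>D. E a z \<and> E a z'))) \<longrightarrow>
        (\<exists>y\<in>D. \<forall>z\<in>D. E z x \<longrightarrow> (\<exists>b\<in>D. E b z) \<longrightarrow>
           (\<exists>a\<in>D. E a z \<and> E a y \<and> (\<forall>b\<in>D. E b z \<and> E b y \<longrightarrow> b = a))))"
  by (simp only: AC_def sat_in.simps sat_in_AC_h1 sat_in_AC_h2 sat_in_choice_set One_nat_def nat.case)

lemma sat_in_AC_star:
  "sat_in D E s AC_star \<longleftrightarrow>
   (\<forall>x\<in>D. (\<forall>z\<in>D. E z x \<longrightarrow> (\<exists>a\<in>D. E a z \<and> (\<forall>z'\<in>D. E z' x \<longrightarrow> z \<noteq> z' \<longrightarrow> \<not> E a z'))) \<longrightarrow>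
        (\<exists>y\<in>D. \<not> E y x \<and>
           (\<forall>z\<in>D. E z x \<longrightarrow> (\<exists>b\<in>D. E b z) \<longrightarrow>
              (\<exists>a\<in>D. E a z \<and> E a y \<and> (\<forall>b\<in>D. E b z \<and> E b y \<longrightarrow> b = a)))))"
  by (simp only: AC_star_def sat_in.simps sat_in_Neg sat_in_AC_h_star sat_in_choice_set One_nat_def
      nat.case)

text \<open>Separation by \<open>Bot\<close> gives the empty set \<open>e\<close>, which differs
  from its singleton \<open>f\<close>; at least one of the two is not \<open>a\<close>.\<close>

lemma ex_other_element:
  assumes ax: "\<forall>q\<in>axioms. sat_in D E s q" and a: "a \<in> D"
  shows "\<exists>b\<in>D. b \<noteq> a"
proof -
  obtain e where e: "e \<in> D" "\<forall>z\<in>D. \<not> E z e"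
    using sat_in_separation[OF ax, of "\<lambda>_. a" Bot a] a by (auto intro: bounded.intros)
  obtain f where "f \<in> D" "\<forall>z\<in>D. E z f \<longleftrightarrow> z = e"
    using sat_in_pairing[OF ax e(1) e(1)] by auto
  with e show ?thesis by metis
qed

lemma AC_imp_AC_star_in_model:
  assumes ax: "\<forall>q\<in>axioms. sat_in D E s q" and AC: "sat_in D E s AC"
  shows "sat_in D E s AC_star"
  unfolding sat_in_AC_star
proof (intro ballI impI)
  fix x
  assume x: "x \<in> D"
    and star: "\<forall>z\<in>D. E z x \<longrightarrow> (\<exists>a\<in>D. E a z \<and> (\<forall>z'\<in>D. E z' x \<longrightarrow> z \<noteq> z' \<longrightarrow> \<not> E a z'))"
  define priv where "priv a z \<longleftrightarrow> (\<forall>w\<in>D. E w x \<longrightarrow> z \<noteq> w \<longrightarrow> \<not> E a w)" for a z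
  define part where "part u z \<longleftrightarrow> (\<forall>a\<in>D. E a u \<longleftrightarrow> E a z \<and> priv a z)" for u z
  have privD: "z = w" if "priv a z" "w \<in> D" "E w x" "E a w" for a z w
    using that by (auto simp: priv_def)
  have partD: "E a u \<longleftrightarrow> E a z \<and> priv a z" if "part u z" "a \<in> D" for a u z
    using that by (auto simp: part_def)
  \<comment> \<open>The separated set \<open>z\<close> has index \<open>1\<close>; the constant
    assignment puts the parameter \<open>x\<close> at index \<open>2\<close>.\<close>
  have part_ex: "\<exists>u\<in>D. part u z" if "z \<in> D" for z
    using sat_in_separation[OF ax, of "\<lambda>_. x" "private_elem 0 1 2" z] that x
    by (simp add: bounded_private_elem sat_in_private_elem part_def priv_def numeral_2_eq_2)
  have part_unique: "u = v" if "u \<in> D" "v \<in> D" "part u z" "part v z" for u v z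
    using sat_in_extensionality[OF ax that(1,2)] that(3,4) by (simp add: part_def)
  \<comment> \<open>Replacement asks for a function on the whole domain, and \<open>part_ex\<close>
    and \<open>part_unique\<close> indeed hold for every \<open>z\<close>. The resulting
    \<open>Y\<close> may have further members.\<close>
  obtain Y where Y: "Y \<in> D" "\<forall>z\<in>D. E z x \<longrightarrow> (\<exists>u\<in>D. E u Y \<and> part u z)"
  proof -
    have "\<exists>Y\<in>D. \<forall>z\<in>D. E z x \<longrightarrow> (\<exists>u\<in>D. E u Y \<and>
      sat_in D E (case_nat u (case_nat z (case_nat x (\<lambda>_. x)))) (private_part 0 1 2))"
    proof (rule sat_in_replacement[OF ax])
      fix z assume z: "z \<in> D"
      then obtain u where "u \<in> D" "part u z" using part_ex by blast
      with part_unique show "\<exists>a\<in>D.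
          sat_in D E (case_nat a (case_nat z (case_nat x (\<lambda>_. x)))) (private_part 0 1 2) \<and>
          (\<forall>b\<in>D. sat_in D E (case_nat b (case_nat z (case_nat x (\<lambda>_. x)))) (private_part 0 1 2) \<longrightarrow> b = a)"
        unfolding sat_in_private_part numeral_2_eq_2 One_nat_def nat.case
        unfolding priv_def[symmetric] part_def[symmetric] by blast
    qed (simp_all add: x bounded_private_part)
    then show ?thesis
      unfolding sat_in_private_part numeral_2_eq_2 One_nat_def nat.case
      unfolding priv_def[symmetric] part_def[symmetric] using that by blast
  qed
  \<comment> \<open>Separation trims \<open>Y\<close> to exactly the parts of members of
    \<open>x\<close>. Inside \<open>BEx\<close>, index \<open>0\<close> is \<open>z\<close>,
    \<open>1\<close> is \<open>u\<close> and \<open>3\<close> is \<open>x\<close>.\<close>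
  obtain X where X: "X \<in> D" "\<forall>u\<in>D. E u X \<longleftrightarrow> E u Y \<and> (\<exists>z\<in>D. E z x \<and> part u z)"
    using sat_in_separation[OF ax, of "\<lambda>_. x" "BEx 2 (private_part 1 0 3)" Y] Y(1) x
    by (auto simp: bounded_private_part bounded.intros sat_in_private_part numeral_2_eq_2
        numeral_3_eq_3 part_def priv_def)
  have nonempty: "\<exists>b\<in>D. E b u" if u: "u \<in> D" "E u X" for u
  proof -
    obtain z where z: "z \<in> D" "E z x" "part u z" using X(2) u by auto
    obtain a where "a \<in> D" "E a z" "priv a z" using star z(1,2) unfolding priv_def by blast
    with partD[OF z(3)] show ?thesis by auto
  qed
  have disjoint: "u = v"
    if uv: "u \<in> D" "E u X" "v \<in> D" "E v X" and a: "a \<in> D" "E a u" "E a v" for u v a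
  proof -
    obtain z where z: "z \<in> D" "E z x" "part u z" using X(2) uv by auto
    obtain w where w: "w \<in> D" "E w x" "part v w" using X(2) uv by auto
    \<comment> \<open>\<open>a\<close> is private to \<open>z\<close> but also lies in
      \<open>w\<close>.\<close>
    have "z = w" using privD[of a z w] partD[OF z(3) a(1)] partD[OF w(3) a(1)] a w by simp
    with z w uv part_unique show ?thesis by simp
  qed
  obtain c where c: "c \<in> D"
    "\<And>u. u \<in> D \<Longrightarrow> E u X \<Longrightarrow> \<exists>a\<in>D. E a u \<and> E a c \<and> (\<forall>b\<in>D. E b u \<and> E b c \<longrightarrow> b = a)"
  proof -
    have "(\<forall>z\<in>D. E z X \<longrightarrow> (\<exists>b\<in>D. E b z)) \<and>
      (\<forall>z\<in>D. E z X \<longrightarrow> (\<forall>z'\<in>D. E z' X \<longrightarrow> z \<noteq> z' \<longrightarrow> \<not> (\<exists>a\<in>D. E a z \<and> E a z')))"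
      (is "?nonempty \<and> ?disjoint")
    proof
      show ?nonempty using nonempty by blast
      show ?disjoint using disjoint by blast
    qed
    with AC[unfolded sat_in_AC, THEN bspec, OF X(1)] obtain c where "c \<in> D"
      "\<forall>z\<in>D. E z X \<longrightarrow> (\<exists>b\<in>D. E b z) \<longrightarrow> (\<exists>a\<in>D. E a z \<and> E a c \<and> (\<forall>b\<in>D. E b z \<and> E b c \<longrightarrow> b = a))"
      by blast
    with nonempty show ?thesis by (intro that[of c]) simp_all
  qed
  \<comment> \<open>\<open>c\<close> may contain elements of members of \<open>x\<close> that are
    not private; the intersection removes them. The union of \<open>X\<close> enters only as a
    bounded formula with parameter \<open>X\<close>.\<close>
  obtain d where d: "d \<in> D" "\<forall>a\<in>D. E a d \<longleftrightarrow> E a c \<and> (\<exists>u\<in>D. E u X \<and> E a u)"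
    using sat_in_separation[OF ax, of "\<lambda>_. X" "BEx 2 (Mem 1 0)" c] c(1) X(1)
    by (auto simp: bounded.intros numeral_2_eq_2)
  have d_choice: "\<exists>a\<in>D. E a z \<and> E a d \<and> priv a z \<and> (\<forall>b\<in>D. E b z \<and> E b d \<longrightarrow> b = a)"
    if z: "z \<in> D" "E z x" for z
  proof -
    obtain u where u: "u \<in> D" "E u X" "part u z" using Y(2) X(2) z by blast
    obtain a where a: "a \<in> D" "E a u" "E a c" "\<forall>b\<in>D. E b u \<and> E b c \<longrightarrow> b = a"
      using c(2)[OF u(1,2)] by blast
    \<comment> \<open>\<open>b\<close> lies in the part \<open>v\<close> of some \<open>w\<close>,
      so it is private to \<open>w\<close>; lying also in \<open>z\<close>, it forces
      \<open>w = z\<close> and \<open>v = u\<close>, where \<open>c\<close> has only one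
      element.\<close>
    have "b = a" if b: "b \<in> D" "E b z" "E b d" for b
    proof -
      obtain v where v: "v \<in> D" "E v X" "E b v" "E b c" using d(2) b by blast
      obtain w where w: "w \<in> D" "E w x" "part v w" using X(2) v(1,2) by blast
      have "w = z" using partD[OF w(3) b(1)] v(3) privD[of b w z] z b(2) by simp
      with w u v part_unique have "v = u" by simp
      with v a b show ?thesis by simp
    qed
    moreover have "E a d" using d(2) a u by blast
    ultimately show ?thesis using a(1,2) partD[OF u(3)] by blast
  qed
  show "\<exists>y\<in>D. \<not> E y x \<and> (\<forall>z\<in>D. E z x \<longrightarrow> (\<exists>b\<in>D. E b z) \<longrightarrow>
          (\<exists>a\<in>D. E a z \<and> E a y \<and> (\<forall>b\<in>D. E b z \<and> E b y \<longrightarrow> b = a)))"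
  proof (cases "E d x")
    case False
    with d(1) d_choice show ?thesis by blast
  next
    case True
    \<comment> \<open>Every member of \<open>x\<close> meets \<open>d = {a}\<close>, but \<open>a\<close> lies in no member other than \<open>d\<close>.\<close>
    obtain a where a: "a \<in> D" "E a d" "priv a d" "\<forall>b\<in>D. E b d \<longrightarrow> b = a"
      using d_choice[OF d(1) True] by blast
    have x_only: "z = d" if "z \<in> D" "E z x" for z
      using d_choice[OF that] a that unfolding priv_def by metis
    obtain b where b: "b \<in> D" "b \<noteq> a" using ex_other_element[OF ax a(1)] by blast
    obtain e where e: "e \<in> D" "\<forall>z\<in>D. E z e \<longleftrightarrow> z = a \<or> z = b"
      using sat_in_pairing[OF ax a(1) b(1)] by blast
    \<comment> \<open>\<open>b\<close> is in \<open>e\<close> but not in \<open>d\<close>. As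
      \<open>d\<close> is the only possible member of \<open>x\<close>, this keeps \<open>e\<close>
      out of \<open>x\<close>, and \<open>e\<close> meets \<open>d\<close> in \<open>a\<close>
      alone.\<close>
    have "e \<noteq> d" using a(4) b e(2) by blast
    with e x_only a show ?thesis by (intro bexI[of _ e]) blast+
  qed
qed

text \<open>Leaves all variables free to serve as Henkin constants.\<close>

lemma fv_axioms: "p \<in> axioms \<Longrightarrow> fv p = {}"
  by (auto simp: axioms_def closures_def extensionality_def pairing_def Iff_def)

theorem theorem3p7:
  shows "axioms \<turnstile> Imp AC AC_star"
proof (rule completeness)
  have "\<Union>(fv ` axioms) = {}" using fv_axioms by blast
  then show "infinite (- (\<Union>(fv ` axioms)))" by simp
qed (simp add: AC_imp_AC_star_in_model)

end
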